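(* Let $m$ be a positive integer and let $P=\mathrm{int}\left(\bigcup_{j=1}^m P_j\right)\subset\mathbb{R}^2$ be a polygonal ring domain, where $P_1,\dots,P_m$ are the associated closed convex quadrilaterals, $I_j$ and $E_j$ are opposite sides of $P_j$ ($j=1,\dots,m$), $\bigcup_{j=1}^m I_j$ is the inner boundary component of $P$ and $\bigcup_{j=1}^m E_j$ is the exterior boundary component of $P$. Denote $\Gamma_j=\Delta(I_j,E_j;P_j)$ for $j=1,\dots,m$. Then $$\mathrm{cap}\Big(P,\bigcup_{j=1}^m I_j\Big)\ \ge\ \sum_{j=1}^m \mathsf{M}(\Gamma_j).$$
   Context: A domain $G\subset\mathbb{R}^2$ is a ring domain if it is homeomorphic to an annulus $\{z: s<|z|<t\}$ for some $0<s<t$. Polygonal ring domain: there exist closed convex quadrilaterals $P_j$, $j=1,\dots,m$, in the plane with $\mathrm{int}\,P_j\cap \mathrm{int}\,P_k=\varnothing$ for all $j\ne k$ such that $P=\mathrm{int}\left(\bigcup_{j=1}^m P_j\right)$ is a ring domain and both its boundary components are polygonal with $m$ vertices. Moreover, the inner boundary component of $P$ can be written as $\bigcup_{j=1}^m I_j$ and the exterior boundary component as $\bigcup_{j=1}^m E_j$, where $I_j$ and $E_j$ are opposite sides of $P_j$. Curve families: for nonempty sets $E,F$ and a set $G$, $\Delta(E,F;G)$ is the family of all curves joining $E$ and $F$ in the closure of $G$. For a family $\Gamma$ of curves in $\mathbb{R}^2$, $\mathsf{M}(\Gamma)$ is its conformal modulus, $\mathsf{M}(\Gamma)=\inf_\rho\int_{\mathbb{R}^2}\rho^2\,dm$,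 the infimum being over all Borel functions $\rho:\mathbb{R}^2\to[0,\infty]$ with $\int_\gamma\rho\,ds\ge 1$ for every locally rectifiable $\gamma\in\Gamma$ ($dm$ is two-dimensional Lebesgue measure). Capacity of the ring domain: $\mathrm{cap}\big(P,\bigcup_{j=1}^m I_j\big)$ denotes the conformal capacity of the ring domain $P$ between its two boundary components, that is, $$\mathrm{cap}\Big(P,\bigcup_{j=1}^m I_j\Big)=\mathsf{M}\Big(\Delta\Big(\bigcup_{j=1}^m I_j,\bigcup_{j=1}^m E_j;P\Big)\Big).$$ *)

theory Defs
  imports "HOL-Analysis.Analysis"
begin

section \<open>Ring domains and polygonal ring domains\<close>

definition ring_domain :: "(real^2) set \<Rightarrow> bool" where
  "ring_domain G \<longleftrightarrow> open G \<and> connected G \<and>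
     (\<exists>s t. 0 < s \<and> s < t \<and> G homeomorphic {z :: real^2. s < norm z \<and> norm z < t})"

text \<open>
  \<^const>\<open>inside\<close> and \<^const>\<open>outside\<close> are the unions of the bounded and of the unbounded
  components of the complement.  For a bounded ring domain each of them is a single component,
  and each contains exactly one component of the boundary.
\<close>

definition inner_boundary_component :: "(real^2) set \<Rightarrow> (real^2) set \<Rightarrow> bool" where
  "inner_boundary_component G C \<longleftrightarrow> C \<in> components (frontier G) \<and> C \<subseteq> inside G"

definition exterior_boundary_component :: "(real^2) set \<Rightarrow> (real^2) set \<Rightarrow> bool" where
  "exterior_boundary_component G C \<longleftrightarrow> C \<in> components (frontier G) \<and> C \<subseteq> outside G"

definition closed_convex_quadrilateral :: "(real^2) set \<Rightarrow> bool" where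
  "closed_convex_quadrilateral Q \<longleftrightarrow>
     polytope Q \<and> aff_dim Q = 2 \<and> card {v. v extreme_point_of Q} = 4"

text \<open>Two sides of a quadrilateral are opposite if they have no vertex in common.\<close>

definition opposite_sides :: "(real^2) set \<Rightarrow> (real^2) set \<Rightarrow> (real^2) set \<Rightarrow> bool" where
  "opposite_sides Q A B \<longleftrightarrow> A edge_of Q \<and> B edge_of Q \<and> A \<inter> B = {}"

text \<open>
  A simple closed polygon with the \<open>m\<close> distinct vertices \<open>v 0, \<dots>, v (m - 1)\<close> in cyclic order.
  Simplicity is expressed by the disjointness of the half-open sides, each side being taken
  without its final endpoint.  Straight angles at vertices are allowed.
\<close>

definition polygon_with_vertices :: "nat \<Rightarrow> (real^2) set \<Rightarrow> bool" where
  "polygon_with_vertices m C \<longleftrightarrow> 3 \<le> m \<and>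
     (\<exists>v :: nat \<Rightarrow> real^2.
        inj_on v {..<m} \<and>
        disjoint_family_on
          (\<lambda>i. closed_segment (v i) (v (Suc i mod m)) - {v (Suc i mod m)}) {..<m} \<and>
        C = (\<Union>i<m. closed_segment (v i) (v (Suc i mod m))))"

definition polygonal_ring_domain ::
    "nat \<Rightarrow> (nat \<Rightarrow> (real^2) set) \<Rightarrow> (nat \<Rightarrow> (real^2) set) \<Rightarrow> (nat \<Rightarrow> (real^2) set) \<Rightarrow>
     (real^2) set \<Rightarrow> bool" where
  "polygonal_ring_domain m Q I E P \<longleftrightarrow>
     (\<forall>j\<in>{1..m}. closed_convex_quadrilateral (Q j)) \<and>
     (\<forall>j\<in>{1..m}. \<forall>k\<in>{1..m}. j \<noteq> k \<longrightarrow> interior (Q j) \<inter> interior (Q k) = {}) \<and>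
     P = interior (\<Union>j\<in>{1..m}. Q j) \<and>
     ring_domain P \<and>
     (\<forall>C. inner_boundary_component P C \<or> exterior_boundary_component P C
          \<longrightarrow> polygon_with_vertices m C) \<and>
     (\<forall>j\<in>{1..m}. opposite_sides (Q j) (I j) (E j)) \<and>
     inner_boundary_component P (\<Union>j\<in>{1..m}. I j) \<and>
     exterior_boundary_component P (\<Union>j\<in>{1..m}. E j)"


section \<open>Curves, length and line integrals\<close>

text \<open>
  Curves are parametrized by \<open>{0..1}\<close> as in the theory of \<^const>\<open>path\<close>.  Length is the supremum of
  the lengths of inscribed polygonal lines over all finite nondecreasing choices of parameters.
\<close>

definition curve_length :: "(real \<Rightarrow> 'a::metric_space) \<Rightarrow> real \<Rightarrow> real \<Rightarrow> ennreal" where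
  "curve_length g a b =
     (SUP (n, t) \<in> {(n :: nat, t :: nat \<Rightarrow> real). mono t \<and> range t \<subseteq> {a..b}}.
        \<Sum>k<n. ennreal (dist (g (t k)) (g (t (Suc k)))))"

definition locally_rectifiable :: "(real \<Rightarrow> 'a::metric_space) \<Rightarrow> bool" where
  "locally_rectifiable g \<longleftrightarrow>
     (\<forall>a b. 0 \<le> a \<and> a \<le> b \<and> b \<le> 1 \<longrightarrow> curve_length g a b < \<infinity>)"

definition arc_length :: "(real \<Rightarrow> 'a::metric_space) \<Rightarrow> real \<Rightarrow> real" where
  "arc_length g x = enn2real (curve_length g 0 x)"

text \<open>
  The arc length parametrization of a rectifiable path \<open>g\<close>, defined on \<open>{0..arc_length g 1}\<close>.  The
  choice made by \<^const>\<open>inv_into\<close> is immaterial, since \<open>g\<close> is constant wherever \<open>arc_length g\<close> is.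
\<close>

definition arc_length_param :: "(real \<Rightarrow> 'a::metric_space) \<Rightarrow> real \<Rightarrow> 'a" where
  "arc_length_param g u = g (inv_into {0..1} (arc_length g) u)"

definition line_integral :: "('a::metric_space \<Rightarrow> ennreal) \<Rightarrow> (real \<Rightarrow> 'a) \<Rightarrow> ennreal" where
  "line_integral \<rho> g =
     (\<integral>\<^sup>+ u \<in> {0..arc_length g 1}. \<rho> (arc_length_param g u) \<partial>lborel)"


section \<open>Curve families, conformal modulus and capacity\<close>

text \<open>The family of curves joining \<open>E\<close> and \<open>F\<close> in the closure of \<open>G\<close>, in either direction.\<close>

definition curve_family ::
    "'a::metric_space set \<Rightarrow> 'a set \<Rightarrow> 'a set \<Rightarrow> (real \<Rightarrow> 'a) set" ("\<Delta>'(_,/ _;/ _')") where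
  "\<Delta>(E, F; G) = {g. path g \<and> path_image g \<subseteq> closure G \<and>
     (pathstart g \<in> E \<and> pathfinish g \<in> F \<or> pathstart g \<in> F \<and> pathfinish g \<in> E)}"

definition admissible :: "(real \<Rightarrow> real^2) set \<Rightarrow> (real^2 \<Rightarrow> ennreal) \<Rightarrow> bool" where
  "admissible \<Gamma> \<rho> \<longleftrightarrow> \<rho> \<in> borel_measurable borel \<and>
     (\<forall>g\<in>\<Gamma>. locally_rectifiable g \<longrightarrow> 1 \<le> line_integral \<rho> g)"

definition modulus :: "(real \<Rightarrow> real^2) set \<Rightarrow> ennreal" where
  "modulus \<Gamma> = (INF \<rho> \<in> {\<rho>. admissible \<Gamma> \<rho>}. \<integral>\<^sup>+ z. (\<rho> z)\<^sup>2 \<partial>lborel)"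

text \<open>The conformal capacity of a ring domain \<open>G\<close> with boundary components \<open>A\<close> and \<open>B\<close>.\<close>

definition ring_capacity :: "(real^2) set \<Rightarrow> (real^2) set \<Rightarrow> (real^2) set \<Rightarrow> ennreal" where
  "ring_capacity G A B = modulus (\<Delta>(A, B; G))"

end

theory Submission
  imports Defs
begin

text \<open>
  A curve joining \<open>I\<^sub>j\<close> and \<open>E\<^sub>j\<close> in \<open>Q\<^sub>j\<close> also joins the boundary components in the closure of \<open>P\<close>.
  So if \<open>\<rho>\<close> is admissible for the ring, its restriction to \<open>Q\<^sub>j\<close> is admissible for the family of
  \<open>Q\<^sub>j\<close>.  The \<open>Q\<^sub>j\<close> overlap only in null sets, hence the energies of the restrictions add
  up to at most the energy of \<open>\<rho>\<close>.  The one delicate point is that the arc length parametrization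
  takes its values on the curve itself, which requires the arc length function of a continuous
  rectifiable curve to attain every intermediate value.
\<close>

section \<open>Arc length\<close>

lemma curve_length_ge:
  assumes "mono t" "range t \<subseteq> {a..b}"
  shows "(\<Sum>k<n. ennreal (dist (g (t k)) (g (t (Suc k))))) \<le> curve_length g a b"
  unfolding curve_length_def
  by (rule SUP_upper2[where i = "(n, t)"]) (use assms in auto)

lemma curve_length_le:
  assumes "\<And>n t. mono t \<Longrightarrow> range t \<subseteq> {a..b} \<Longrightarrow>
             (\<Sum>k<n. ennreal (dist (g (t k)) (g (t (Suc k))))) \<le> c"
  shows "curve_length g a b \<le> c"
  unfolding curve_length_def using assms by (auto intro!: SUP_least)

lemma curve_length_mono:
  assumes "c \<le> a" "b \<le> d"
  shows "curve_length g a b \<le> curve_length g c d"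
  by (rule curve_length_le, rule curve_length_ge) (use assms in fastforce)+

lemma curve_length_refl [simp]: "curve_length g a a = 0"
proof -
  have "curve_length g a a \<le> 0"
  proof (rule curve_length_le)
    fix n :: nat and t :: "nat \<Rightarrow> real"
    assume "range t \<subseteq> {a..a}"
    then have "t k = a" for k by (auto simp: image_subset_iff)
    then show "(\<Sum>k<n. ennreal (dist (g (t k)) (g (t (Suc k))))) \<le> 0" by simp
  qed
  then show ?thesis by simp
qed

text \<open>Cutting a node sequence at \<open>x\<close> with \<open>min\<close> and
  \<open>max\<close> yields one node sequence in each half of the interval.\<close>

lemma curve_length_split_le:
  fixes g :: "real \<Rightarrow> 'a::metric_space"
  assumes "a \<le> x" "x \<le> b"
  shows "curve_length g a b \<le> curve_length g a x + curve_length g x b"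
proof (rule curve_length_le)
  fix n :: nat and t :: "nat \<Rightarrow> real"
  assume t: "mono t" "range t \<subseteq> {a..b}"
  let ?l = "\<lambda>k. min (t k) x" and ?r = "\<lambda>k. max (t k) x"
  \<comment> \<open>Only a segment that straddles \<open>x\<close> needs the triangle inequality,
    through \<open>g x\<close>. For any other segment one of the two clamped segments is
    degenerate.\<close>
  have "dist (g (t k)) (g (t (Suc k)))
      \<le> dist (g (?l k)) (g (?l (Suc k))) + dist (g (?r k)) (g (?r (Suc k)))" for k
    using monoD[OF t(1), of k "Suc k"] dist_triangle[of "g (t k)" "g (t (Suc k))" "g x"]
    by (cases "t k \<le> x"; cases "t (Suc k) \<le> x") (auto simp: min_def max_def)
  then have "(\<Sum>k<n. ennreal (dist (g (t k)) (g (t (Suc k)))))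
      \<le> (\<Sum>k<n. ennreal (dist (g (?l k)) (g (?l (Suc k))))) +
        (\<Sum>k<n. ennreal (dist (g (?r k)) (g (?r (Suc k)))))"
    unfolding sum.distrib[symmetric] by (intro sum_mono) (simp add: ennreal_plus[symmetric] del: ennreal_plus)
  also have "\<dots> \<le> curve_length g a x + curve_length g x b"
  proof (intro add_mono curve_length_ge)
    show "mono ?l" "mono ?r"
      by (auto intro!: monoI min.mono max.mono monoD[OF t(1)])
    show "range ?l \<subseteq> {a..x}" "range ?r \<subseteq> {x..b}"
      using t(2) assms by (auto simp: image_subset_iff)
  qed
  finally show "(\<Sum>k<n. ennreal (dist (g (t k)) (g (t (Suc k)))))
      \<le> curve_length g a x + curve_length g x b" .
qed

lemma sum_lessThan_add:
  fixes f :: "nat \<Rightarrow> 'a::comm_monoid_add"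
  shows "(\<Sum>k<m + n. f k) = (\<Sum>k<m. f k) + (\<Sum>k<n. f (m + k))"
  by (induction n) (auto simp: add.assoc)

text \<open>Inscribed polygons of the two halves can be concatenated, and the segment that links
  them only adds length. The two suprema are then taken one after the other.\<close>

lemma curve_length_split_ge:
  fixes g :: "real \<Rightarrow> 'a::metric_space"
  assumes "a \<le> x" "x \<le> b"
  shows "curve_length g a x + curve_length g x b \<le> curve_length g a b"
proof -
  have concat: "(\<Sum>k<n. ennreal (dist (g (t k)) (g (t (Suc k))))) +
        (\<Sum>k<p. ennreal (dist (g (s k)) (g (s (Suc k))))) \<le> curve_length g a b"
    if t: "mono t" "range t \<subseteq> {a..x}" and s: "mono s" "range s \<subseteq> {x..b}" for n p t s
  proof -
    \<comment> \<open>\<open>t\<close> contributes the nodes up to index \<open>n\<close> and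
      \<open>s 0\<close> sits at index \<open>Suc n\<close>, so there is one linking segment and
      \<open>n + Suc p\<close> segments in all.\<close>
    define r where "r k = (if k \<le> n then t k else s (k - Suc n))" for k
    have "(\<Sum>k<n + Suc p. ennreal (dist (g (r k)) (g (r (Suc k))))) =
        (\<Sum>k<n. ennreal (dist (g (t k)) (g (t (Suc k))))) +
        (ennreal (dist (g (t n)) (g (s 0))) +
         (\<Sum>k<p. ennreal (dist (g (s k)) (g (s (Suc k))))))"
      by (simp add: sum_lessThan_add sum.lessThan_Suc_shift r_def del: add_Suc_right sum.lessThan_Suc)
    moreover have "(\<Sum>k<n + Suc p. ennreal (dist (g (r k)) (g (r (Suc k))))) \<le> curve_length g a b"
    proof (rule curve_length_ge)
      have tx: "a \<le> t i" "t i \<le> x" and sx: "x \<le> s i" "s i \<le> b" for i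
        using t(2) s(2) by (auto simp: image_subset_iff)
      show "mono r"
        using t(1) s(1) order_trans[OF tx(2) sx(1)] by (auto simp: mono_def r_def)
      show "range r \<subseteq> {a..b}"
        using tx sx order_trans[OF tx(2) assms(2)] order_trans[OF assms(1) sx(1)]
        by (auto simp: r_def)
    qed
    ultimately show ?thesis
      by (auto elim!: order_trans[rotated] intro!: add_left_mono)
  qed
  let ?T = "\<lambda>a b. {(n :: nat, t :: nat \<Rightarrow> real). mono t \<and> range t \<subseteq> {a..b}}"
  let ?S = "\<lambda>(n, t). \<Sum>k<n. ennreal (dist (g (t k)) (g (t (Suc k))))"
  \<comment> \<open>Moving a summand into a supremum requires a nonempty index set; the constant
    sequence at \<open>x\<close> lies in both.\<close>
  have ne: "?T a x \<noteq> {}" "?T x b \<noteq> {}"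
    using assms by (auto intro!: exI[of _ "\<lambda>_. x"] simp: mono_def)
  have "curve_length g a x + curve_length g x b = (SUP u\<in>?T a x. ?S u + curve_length g x b)"
    unfolding curve_length_def using ne(1) by (rule ennreal_SUP_add_left[symmetric])
  also have "\<dots> = (SUP u\<in>?T a x. SUP v\<in>?T x b. ?S u + ?S v)"
    unfolding curve_length_def using ne(2) by (simp add: ennreal_SUP_add_right)
  also have "\<dots> \<le> curve_length g a b"
    using concat by (intro SUP_least) auto
  finally show ?thesis .
qed

text \<open>
  Clamping the nodes of inscribed polygons to a variable interval shows that the curve length is
  lower semicontinuous in either endpoint.
\<close>

lemma closed_curve_length_right:
  fixes g :: "real \<Rightarrow> 'a::metric_space"
  assumes g: "continuous_on {a..b} g"
  shows "closed {x \<in> {a..b}. curve_length g a x \<le> c}"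
proof -
  let ?T = "{(n :: nat, t :: nat \<Rightarrow> real). mono t \<and> range t \<subseteq> {a..b}}"
  let ?S = "\<lambda>x (n, t). \<Sum>k<n. ennreal (dist (g (min (t k) x)) (g (min (t (Suc k)) x)))"
  \<comment> \<open>The index set \<open>?T\<close> is independent of \<open>x\<close>, so the
    sublevel set becomes an intersection of sublevel sets of functions continuous in
    \<open>x\<close>.\<close>
  have "{x \<in> {a..b}. curve_length g a x \<le> c} = {x \<in> {a..b}. \<forall>u\<in>?T. ?S x u \<le> c}"
  proof (intro Collect_cong conj_cong refl iffI ballI)
    fix x u assume x: "x \<in> {a..b}" "curve_length g a x \<le> c" and "u \<in> ?T"
    then obtain n t where [simp]: "u = (n, t)" and t: "mono t" "range t \<subseteq> {a..b}" by auto
    have "?S x u \<le> curve_length g a x"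
    proof -
      have "mono (\<lambda>k. min (t k) x)" by (auto intro!: monoI min.mono monoD[OF t(1)])
      moreover have "range (\<lambda>k. min (t k) x) \<subseteq> {a..x}"
        using t(2) x by (auto simp: image_subset_iff)
      ultimately show ?thesis
        using curve_length_ge[of "\<lambda>k. min (t k) x" a x g n] by simp
    qed
    then show "?S x u \<le> c" using x by simp
  next
    fix x assume x: "x \<in> {a..b}" and le: "\<forall>u\<in>?T. ?S x u \<le> c"
    show "curve_length g a x \<le> c"
    proof (rule curve_length_le)
      fix n :: nat and t :: "nat \<Rightarrow> real"
      assume t: "mono t" "range t \<subseteq> {a..x}"
      then have "min (t k) x = t k" for k by (auto simp: image_subset_iff min_def)
      moreover have "?S x (n, t) \<le> c"
        using le t x by (intro le[rule_format]) (auto simp: image_subset_iff intro: order_trans)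
      ultimately show "(\<Sum>k<n. ennreal (dist (g (t k)) (g (t (Suc k))))) \<le> c" by simp
    qed
  qed
  also have "\<dots> = {a..b} \<inter> (\<Inter>u\<in>?T. {x \<in> {a..b}. ?S x u \<le> c})" by auto
  also have "closed \<dots>"
  proof (intro closed_Int closed_INT ballI closed_atLeastAtMost)
    fix u assume "u \<in> ?T"
    then obtain n t where [simp]: "u = (n, t)" and t: "range t \<subseteq> {a..b}" by auto
    have "continuous_on {a..b} (\<lambda>x. g (min (t k) x))" for k
      by (rule continuous_on_compose2[OF g])
         (use t in \<open>auto intro!: continuous_intros simp: image_subset_iff min_le_iff_disj\<close>)
    then have "continuous_on {a..b} (\<lambda>x. ?S x u)"
      by (auto intro!: continuous_intros continuous_on_sum continuous_on_ennreal)
    then show "closed {x \<in> {a..b}. ?S x u \<le> c}"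
      using continuous_closed_preimage[of "{a..b}" "\<lambda>x. ?S x u" "{..c}"]
      by (simp add: vimage_def Int_def)
  qed
  finally show ?thesis .
qed

section \<open>Curve length under reversal of the parameter\<close>

lemma curve_length_reverse_le:
  "curve_length g a b \<le> curve_length (\<lambda>x. g (- x)) (- b) (- a)"
proof (rule curve_length_le)
  fix n :: nat and t :: "nat \<Rightarrow> real"
  assume t: "mono t" "range t \<subseteq> {a..b}"
  \<comment> \<open>Truncated subtraction freezes \<open>s\<close> at \<open>- t 0\<close> from
    index \<open>n\<close> on, so \<open>s\<close> is monotone on all naturals.\<close>
  define s where "s k = - t (n - k)" for k
  have "(\<Sum>k<n. ennreal (dist (g (t k)) (g (t (Suc k)))))
      = (\<Sum>k<n. ennreal (dist (g (t (n - Suc k))) (g (t (Suc (n - Suc k))))))"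
    by (rule sum.nat_diff_reindex[symmetric])
  also have "\<dots> = (\<Sum>k<n. ennreal (dist (g (- s k)) (g (- s (Suc k)))))"
    by (intro sum.cong) (auto simp: s_def Suc_diff_Suc dist_commute)
  also have "\<dots> \<le> curve_length (\<lambda>x. g (- x)) (- b) (- a)"
    by (rule curve_length_ge[where g = "\<lambda>x. g (- x)"])
       (use t in \<open>auto simp: s_def mono_def image_subset_iff intro!: monoD[OF t(1)]\<close>)
  finally show "(\<Sum>k<n. ennreal (dist (g (t k)) (g (t (Suc k)))))
      \<le> curve_length (\<lambda>x. g (- x)) (- b) (- a)" .
qed

lemma curve_length_reverse:
  "curve_length (\<lambda>x. g (- x)) (- b) (- a) = curve_length g a b"
  using curve_length_reverse_le[of g a b] curve_length_reverse_le[of "\<lambda>x. g (- x)" "- b" "- a"]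
  by (intro antisym) auto

lemma closed_curve_length_left:
  fixes g :: "real \<Rightarrow> 'a::metric_space"
  assumes g: "continuous_on {a..b} g"
  shows "closed {x \<in> {a..b}. curve_length g x b \<le> c}"
proof -
  have "continuous_on {-b..-a} (\<lambda>x. g (- x))"
    by (rule continuous_on_compose2[OF g]) (auto intro!: continuous_intros)
  then have "closed (uminus ` {x \<in> {-b..-a}. curve_length (\<lambda>x. g (- x)) (- b) x \<le> c})"
    by (intro closed_negations closed_curve_length_right)
  also have "uminus ` {x \<in> {-b..-a}. curve_length (\<lambda>x. g (- x)) (- b) x \<le> c}
      = {x \<in> {a..b}. curve_length g x b \<le> c}"
  proof -
    have "curve_length (\<lambda>x. g (- x)) (- b) x = curve_length g (- x) b" for x
      using curve_length_reverse[of g b "- x"] by simp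
    then show ?thesis by (force intro: image_eqI[where x = "- x" for x])
  qed
  finally show ?thesis .
qed

text \<open>Connectedness of the unit interval replaces continuity of the arc length. The sets where
  arc length is at most \<open>u\<close> and at least \<open>u\<close> cover the interval, each
  contains an endpoint, and both are closed, so they meet.\<close>

lemma arc_length_surj:
  fixes g :: "real \<Rightarrow> 'a::metric_space"
  assumes "path g" and rect: "curve_length g 0 1 < \<infinity>" and u: "u \<in> {0..arc_length g 1}"
  shows "u \<in> arc_length g ` {0..1}"
proof -
  have g: "continuous_on {0..1} g" using assms(1) by (simp add: path_def)
  have fin: "curve_length g x y < \<infinity>" if "0 \<le> x" "y \<le> 1" for x y
    using curve_length_mono[OF that, of g] rect by (rule order_le_less_trans)
  define L where "L x = enn2real (curve_length g 0 x)" for x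
  define R where "R x = enn2real (curve_length g x 1)" for x
  have L: "curve_length g 0 x = ennreal (L x)" and R: "curve_length g x 1 = ennreal (R x)"
    if "x \<in> {0..1}" for x
    using fin[of 0 x] fin[of x 1] that by (auto simp: L_def R_def)
  have nn: "0 \<le> L x" "0 \<le> R x" for x by (auto simp: L_def R_def)
  have add: "L x + R x = L 1" if x: "x \<in> {0..1}" for x
  proof -
    have "ennreal (L x) + ennreal (R x) = ennreal (L 1)"
      using curve_length_split_le[of 0 x 1 g] curve_length_split_ge[of 0 x 1 g] x
      by (auto simp: L[symmetric] R[symmetric] intro: antisym)
    then show ?thesis using nn by (simp add: ennreal_plus[symmetric] del: ennreal_plus)
  qed
  have u01: "0 \<le> u" "u \<le> L 1" using u by (auto simp: L_def arc_length_def)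
  let ?A = "{x \<in> {0..1}. curve_length g 0 x \<le> ennreal u}"
  \<comment> \<open>By additivity this is the set where \<open>L x\<close> is at least
    \<open>u\<close>. Written through the remaining length, it is closed by lower
    semicontinuity.\<close>
  let ?B = "{x \<in> {0..1}. curve_length g x 1 \<le> ennreal (L 1 - u)}"
  have A: "x \<in> ?A \<longleftrightarrow> L x \<le> u" and B: "x \<in> ?B \<longleftrightarrow> u \<le> L x" if "x \<in> {0..1}" for x
    using that u01 nn add[OF that] by (auto simp: L R)
  have "\<exists>x\<in>{0..1}. x \<in> ?A \<and> x \<in> ?B"
  proof (rule ccontr)
    assume "\<not> ?thesis"
    then have "?A \<inter> ?B \<inter> {0..1} = {}" by blast
    moreover have "{0..1} \<subseteq> ?A \<union> ?B" using A B by fastforce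
    moreover have "0 \<in> ?A" "1 \<in> ?B" using A[of 0] B[of 1] u01 by (auto simp: L_def)
    moreover have "0 \<in> {0..1::real}" "1 \<in> {0..1::real}" by auto
    ultimately show False
      using connected_closedD[OF connected_Icc[of "0::real" 1], of ?A ?B]
        closed_curve_length_right[OF g] closed_curve_length_left[OF g] by blast
  qed
  then show ?thesis using A B by (auto simp: L_def arc_length_def image_iff intro!: bexI antisym)
qed

lemma arc_length_param_in_path_image:
  assumes "path g" "locally_rectifiable g" "u \<in> {0..arc_length g 1}"
  shows "arc_length_param g u \<in> path_image g"
proof -
  have "u \<in> arc_length g ` {0..1}"
    using assms by (intro arc_length_surj) (auto simp: locally_rectifiable_def)
  then show ?thesis
    unfolding arc_length_param_def path_image_def by (intro imageI inv_into_into)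
qed

section \<open>Modulus\<close>

text \<open>Along a curve inside \<open>S\<close> the line integral samples the density only at
  points of \<open>S\<close>, where the indicator equals 1.\<close>

lemma admissible_indicator:
  assumes "admissible \<Gamma> \<rho>" "\<Gamma>' \<subseteq> \<Gamma>" "S \<in> sets borel"
    and "\<And>g. g \<in> \<Gamma>' \<Longrightarrow> path g \<and> path_image g \<subseteq> S"
  shows "admissible \<Gamma>' (\<lambda>z. \<rho> z * indicator S z)"
proof -
  have "line_integral (\<lambda>z. \<rho> z * indicator S z) g = line_integral \<rho> g"
    if "g \<in> \<Gamma>'" "locally_rectifiable g" for g
    unfolding line_integral_def using assms(4) that arc_length_param_in_path_image[of g]
    by (intro nn_integral_cong) (auto simp: indicator_def subset_iff)
  then show ?thesis using assms by (auto simp: admissible_def)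
qed

lemma sum_modulus_le_modulus:
  assumes "finite J" and sub: "\<And>j. j \<in> J \<Longrightarrow> \<Gamma>' j \<subseteq> \<Gamma>"
    and S: "\<And>j. j \<in> J \<Longrightarrow> S j \<in> sets borel"
    and curves: "\<And>j g. j \<in> J \<Longrightarrow> g \<in> \<Gamma>' j \<Longrightarrow> path g \<and> path_image g \<subseteq> S j"
    and disj: "AE z in lborel. \<forall>j\<in>J. \<forall>k\<in>J. z \<in> S j \<and> z \<in> S k \<longrightarrow> j = k"
  shows "(\<Sum>j\<in>J. modulus (\<Gamma>' j)) \<le> modulus \<Gamma>"
  unfolding modulus_def[of \<Gamma>]
proof (rule INF_greatest)
  fix \<rho> assume "\<rho> \<in> {\<rho>. admissible \<Gamma> \<rho>}"
  then have \<rho>: "admissible \<Gamma> \<rho>" by simp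
  then have [measurable]: "\<rho> \<in> borel_measurable borel" by (simp add: admissible_def)
  note [measurable] = S
  have "(\<Sum>j\<in>J. modulus (\<Gamma>' j)) \<le> (\<Sum>j\<in>J. \<integral>\<^sup>+ z. (\<rho> z * indicator (S j) z)\<^sup>2 \<partial>lborel)"
    unfolding modulus_def
    \<comment> \<open>Each restricted density competes in the infimum for its own family.\<close>
    by (intro sum_mono INF_lower) (use admissible_indicator[OF \<rho> sub S curves] in auto)
  also have "\<dots> = (\<integral>\<^sup>+ z. (\<Sum>j\<in>J. (\<rho> z * indicator (S j) z)\<^sup>2) \<partial>lborel)"
    by (subst nn_integral_sum) auto
  also have "\<dots> \<le> (\<integral>\<^sup>+ z. (\<rho> z)\<^sup>2 \<partial>lborel)"
  proof (rule nn_integral_mono_AE, use disj in eventually_elim)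
    fix z assume z: "\<forall>j\<in>J. \<forall>k\<in>J. z \<in> S j \<and> z \<in> S k \<longrightarrow> j = k"
    show "(\<Sum>j\<in>J. (\<rho> z * indicator (S j) z)\<^sup>2) \<le> (\<rho> z)\<^sup>2"
    proof (cases "\<exists>i\<in>J. z \<in> S i")
      case True
      then obtain i where i: "i \<in> J" "z \<in> S i" by blast
      have "(\<Sum>j\<in>J. (\<rho> z * indicator (S j) z)\<^sup>2) = (\<Sum>j\<in>J. if j = i then (\<rho> z)\<^sup>2 else 0)"
        by (intro sum.cong) (use z i in \<open>auto simp: indicator_def\<close>)
      then show ?thesis using i \<open>finite J\<close> by simp
    qed (auto simp: indicator_def)
  qed
  finally show "(\<Sum>j\<in>J. modulus (\<Gamma>' j)) \<le> (\<integral>\<^sup>+ z. (\<rho> z)\<^sup>2 \<partial>lborel)" .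
qed

text \<open>Frontiers of convex sets are null, and a point of two of the sets that avoids all
  frontiers would lie in both interiors.\<close>

lemma AE_convex_disjoint:
  fixes S :: "'i \<Rightarrow> 'a::euclidean_space set"
  assumes "finite J" "\<And>j. j \<in> J \<Longrightarrow> convex (S j)"
    and disj: "\<And>j k. j \<in> J \<Longrightarrow> k \<in> J \<Longrightarrow> j \<noteq> k \<Longrightarrow> interior (S j) \<inter> interior (S k) = {}"
  shows "AE z in lborel. \<forall>j\<in>J. \<forall>k\<in>J. z \<in> S j \<and> z \<in> S k \<longrightarrow> j = k"
proof -
  have "AE z in lborel. z \<notin> frontier (S j)" if "j \<in> J" for j
  proof (rule AE_not_in)
    have "frontier (S j) \<in> null_sets lebesgue"
      using negligible_convex_frontier assms(2)[OF that] by (simp add: negligible_iff_null_sets)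
    then show "frontier (S j) \<in> null_sets lborel"
      by (simp add: null_sets_completion_iff)
  qed
  then have "AE z in lborel. \<forall>j\<in>J. z \<notin> frontier (S j)"
    using \<open>finite J\<close> by (simp add: AE_finite_all)
  then show ?thesis
  proof eventually_elim
    case (elim z)
    then have "z \<in> interior (S j)" if "j \<in> J" "z \<in> S j" for j
      using that closure_subset[of "S j"] by (auto simp: frontier_def)
    then show ?case using disj by blast
  qed
qed

section \<open>Quadrilaterals and the conclusion for the ring domain\<close>

lemma closed_convex_quadrilateral_props:
  assumes "closed_convex_quadrilateral Q"
  shows "convex Q" "closed Q" "interior Q \<noteq> {}"
  using assms interior_rel_interior_gen[of Q] rel_interior_eq_empty[of Q]
  by (auto simp: closed_convex_quadrilateral_def polytope_imp_convex polytope_imp_closed)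

theorem lemma4p18:
  fixes m :: nat and Q I E :: "nat \<Rightarrow> (real^2) set" and P :: "(real^2) set"
    and \<Gamma> :: "nat \<Rightarrow> (real \<Rightarrow> real^2) set"
  assumes "m \<ge> 1"
    and "polygonal_ring_domain m Q I E P"
    and "\<And>j. j \<in> {1..m} \<Longrightarrow> \<Gamma> j = \<Delta>(I j, E j; Q j)"
  shows "ring_capacity P (\<Union>j\<in>{1..m}. I j) (\<Union>j\<in>{1..m}. E j) \<ge> (\<Sum>j=1..m. modulus (\<Gamma> j))"
proof -
  have quad: "closed_convex_quadrilateral (Q j)" if "j \<in> {1..m}" for j
    using assms(2) that by (auto simp: polygonal_ring_domain_def)
  note props = closed_convex_quadrilateral_props[OF quad]
  have disj: "interior (Q j) \<inter> interior (Q k) = {}"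
    if "j \<in> {1..m}" "k \<in> {1..m}" "j \<noteq> k" for j k
    using assms(2) that by (auto simp: polygonal_ring_domain_def)
  have P: "P = interior (\<Union>j\<in>{1..m}. Q j)"
    using assms(2) by (simp add: polygonal_ring_domain_def)
  have sub: "Q j \<subseteq> closure P" if j: "j \<in> {1..m}" for j
  proof -
    \<comment> \<open>A closed convex set with nonempty interior is the closure of that interior.
      Hence the sides of \<open>Q j\<close> lie in the closure of \<open>P\<close> too, where the
      curves of the ring may run.\<close>
    have "Q j = closure (interior (Q j))"
      using props[OF j] convex_closure_interior[of "Q j"] by simp
    also have "\<dots> \<subseteq> closure P"
      unfolding P using j by (intro closure_mono interior_mono) auto
    finally show ?thesis .
  qed
  show ?thesis
    unfolding ring_capacity_def
  proof (rule sum_modulus_le_modulus[where S = Q])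
    show "\<Gamma> j \<subseteq> \<Delta>(\<Union>j\<in>{1..m}. I j, \<Union>j\<in>{1..m}. E j; P)" if j: "j \<in> {1..m}" for j
      using sub[OF j] props(2)[OF j] j unfolding assms(3)[OF j] curve_family_def
      by (fastforce simp: closure_closed)
    show "AE z in lborel. \<forall>j\<in>{1..m}. \<forall>k\<in>{1..m}. z \<in> Q j \<and> z \<in> Q k \<longrightarrow> j = k"
      using props(1) disj by (intro AE_convex_disjoint) auto
  qed (use props(2) assms(3) in \<open>auto simp: curve_family_def closure_closed\<close>)
qed

end
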